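(* Let $\bar\gamma>0$ and $0<\alpha\le 1$. Let $\gamma$ be the instantaneous SNR of the Rayleigh and double-Rayleigh (RDR) fading channel, i.e. the normalized SOSF fading channel with parameters $(\alpha,\beta)=(\alpha,0)$, with average SNR $\bar\gamma$. Then the PDF of $\gamma$ is, for $\gamma>0$, $$f_\gamma(\gamma)=\frac{1}{\alpha \bar \gamma}\,e^{\frac{1-\alpha}{\alpha}}\, \Gamma\!\left(0,\frac{1-\alpha}{\alpha},\frac{\gamma}{\alpha \bar \gamma} \right).$$
   Context: SOSF (second order scattering fading) channel: $S=\omega_0e^{j\phi}+\omega_1G_1+\omega_2G_2G_3$, where $j$ is the imaginary unit, $\omega_0,\omega_1,\omega_2\ge 0$ are real constants with $\omega_0^2+\omega_1^2+\omega_2^2=1$, $\phi$ is uniform on $[0,2\pi)$, and $G_1,G_2,G_3$ are circularly-symmetric complex Gaussian random variables with mean $0$ and variance $\mathbb{E}|G_i|^2=1$; $\phi,G_1,G_2,G_3$ are mutually independent. The parameters are $\alpha=\omega_2^2$ and $\beta=\omega_0^2$ (so $\omega_1^2=1-\alpha-\beta$). The instantaneous SNR is $\gamma=\bar\gamma|S|^2$, so that $\mathbb{E}(\gamma)=\bar\gamma$. The generalized incomplete gamma function is $\Gamma(a,x,b)=\int_{x}^{\infty}t^{a-1} e^{-t}e^{-b/t}\,dt$. *)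

theory Defs
  imports "HOL-Probability.Probability"
begin

text \<open>
  A circularly-symmetric complex Gaussian of mean \<open>0\<close> and variance \<open>E |G|\<^sup>2 = v\<close> has independent
  real and imaginary parts, each normal with mean \<open>0\<close> and variance \<open>v / 2\<close>.  The second argument
  of \<^const>\<open>normal_density\<close> is the standard deviation; \<open>v\<close> is meant to be positive.
\<close>

definition (in prob_space) circ_sym_gaussian :: "('a \<Rightarrow> complex) \<Rightarrow> real \<Rightarrow> bool" where
  "circ_sym_gaussian G v \<longleftrightarrow>
     random_variable borel G \<and>
     distributed M lborel (\<lambda>\<omega>. Re (G \<omega>)) (normal_density 0 (sqrt (v / 2))) \<and>
     distributed M lborel (\<lambda>\<omega>. Im (G \<omega>)) (normal_density 0 (sqrt (v / 2))) \<and>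
     indep_var borel (\<lambda>\<omega>. Re (G \<omega>)) borel (\<lambda>\<omega>. Im (G \<omega>))"

definition (in prob_space) generated_events :: "('a \<Rightarrow> 'b::topological_space) \<Rightarrow> 'a set set" where
  "generated_events X = {X -` A \<inter> space M | A. A \<in> sets borel}"

text \<open>
  Since \<open>\<phi>\<close> is real and the \<open>G\<^sub>i\<close> are complex, \<open>indep_vars\<close> (whose variables share one type) does
  not apply directly; mutual independence is stated for the four generated sigma-algebras, which
  is what \<open>indep_vars\<close> unfolds to.
\<close>

locale sosf_channel = prob_space M
  for M :: "'a measure" +
  fixes \<omega>\<^sub>0 \<omega>\<^sub>1 \<omega>\<^sub>2 :: real
    and \<phi> :: "'a \<Rightarrow> real"
    and G\<^sub>1 G\<^sub>2 G\<^sub>3 :: "'a \<Rightarrow> complex"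
  assumes amplitudes_nonneg: "\<omega>\<^sub>0 \<ge> 0" "\<omega>\<^sub>1 \<ge> 0" "\<omega>\<^sub>2 \<ge> 0"
    and normalized: "\<omega>\<^sub>0\<^sup>2 + \<omega>\<^sub>1\<^sup>2 + \<omega>\<^sub>2\<^sup>2 = 1"
    and phase_measurable: "random_variable borel \<phi>"
    and phase_uniform: "distr M borel \<phi> = uniform_measure lborel {0..<2 * pi}"
    and gaussian: "circ_sym_gaussian G\<^sub>1 1" "circ_sym_gaussian G\<^sub>2 1" "circ_sym_gaussian G\<^sub>3 1"
    and mutually_indep:
      "indep_sets
         (\<lambda>i. [generated_events \<phi>, generated_events G\<^sub>1,
               generated_events G\<^sub>2, generated_events G\<^sub>3] ! i) {..<4}"

definition sosf_signal ::
  "real \<Rightarrow> real \<Rightarrow> real \<Rightarrow> ('a \<Rightarrow> real) \<Rightarrow> ('a \<Rightarrow> complex) \<Rightarrow> ('a \<Rightarrow> complex) \<Rightarrow> ('a \<Rightarrow> complex)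
     \<Rightarrow> 'a \<Rightarrow> complex" where
  "sosf_signal \<omega>\<^sub>0 \<omega>\<^sub>1 \<omega>\<^sub>2 \<phi> G\<^sub>1 G\<^sub>2 G\<^sub>3 x =
     complex_of_real \<omega>\<^sub>0 * exp (\<i> * complex_of_real (\<phi> x))
     + complex_of_real \<omega>\<^sub>1 * G\<^sub>1 x
     + complex_of_real \<omega>\<^sub>2 * G\<^sub>2 x * G\<^sub>3 x"

definition instantaneous_snr :: "real \<Rightarrow> ('a \<Rightarrow> complex) \<Rightarrow> 'a \<Rightarrow> real" where
  "instantaneous_snr avg S x = avg * (cmod (S x))\<^sup>2"

text \<open>Meaningful for \<open>x \<ge> 0\<close>, and only where the integral converges (e.g. whenever \<open>b > 0\<close>).\<close>

definition gen_inc_Gamma :: "real \<Rightarrow> real \<Rightarrow> real \<Rightarrow> real" where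
  "gen_inc_Gamma a x b = (LBINT t:{x<..}. t powr (a - 1) * exp (- t) * exp (- b / t))"

end

(*
  Conditionally on G3 = z, the signal w1 G1 + w2 z G2 is circularly symmetric Gaussian of variance
  w1^2 + w2^2 |z|^2, because a pair of independent normals of equal variance is rotation invariant.
  The squared modulus of a standard complex Gaussian is exponential (the area of a disc is pi times
  its squared radius), so |S|^2 is a mixture of exponentials of mean w1^2 + w2^2 r with r itself
  exponential.  The substitution t = (1 - alpha) / alpha + r turns the mixture density into the
  generalized incomplete gamma function.
*)
theory Submission
  imports Defs
begin

section \<open>Rotation invariance in the plane: Lebesgue measure and pairs of normals\<close>

text \<open>A rotation with \<open>a \<noteq> 0\<close> splits into two one-dimensional affine
  substitutions. Replacing \<open>x\<close> so that the first argument becomes \<open>u\<close>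
  costs a factor \<open>1 / \<bar>a\<bar>\<close>. The second argument is then affine in
  \<open>y\<close> with slope \<open>1 / a\<close>, and substituting it absorbs exactly that factor.
  For \<open>a = 0\<close> the map swaps the coordinates up to sign.\<close>

lemma nn_integral_lborel_rotation:
  fixes F :: "real \<Rightarrow> real \<Rightarrow> ennreal" and a b :: real
  assumes [measurable]: "case_prod F \<in> borel_measurable (borel \<Otimes>\<^sub>M borel)"
    and ab: "a\<^sup>2 + b\<^sup>2 = 1"
  shows "(\<integral>\<^sup>+x. \<integral>\<^sup>+y. F (a * x - b * y) (b * x + a * y) \<partial>lborel \<partial>lborel)
       = (\<integral>\<^sup>+x. \<integral>\<^sup>+y. F x y \<partial>lborel \<partial>lborel)"
proof (cases "a = 0")
  case False
  have inner: "(\<integral>\<^sup>+x. F (a * x - b * y) (b * x + a * y) \<partial>lborel)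
      = ennreal \<bar>1 / a\<bar> * (\<integral>\<^sup>+u. F u (b / a * u + 1 / a * y) \<partial>lborel)" for y
  proof -
    have e: "b * (b * y / a + 1 / a * u) + a * y = b / a * u + 1 / a * y" for u
    proof -
      \<comment> \<open>The slope in \<open>y\<close> is \<open>(a\<^sup>2 + b\<^sup>2) / a\<close>;
        the normalization reduces it to \<open>1 / a\<close>.\<close>
      have "b * (b * y / a + 1 / a * u) + a * y = b / a * u + (a\<^sup>2 + b\<^sup>2) / a * y"
        using False by (simp add: field_simps power2_eq_square)
      then show ?thesis using ab by simp
    qed
    show ?thesis
      using False
      by (subst nn_integral_real_affine[where c = "1 / a" and t = "b * y / a"])
        (simp_all only: e, simp_all add: field_simps)
  qed
  have "(\<integral>\<^sup>+x. \<integral>\<^sup>+y. F (a * x - b * y) (b * x + a * y) \<partial>lborel \<partial>lborel)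
      = (\<integral>\<^sup>+y. \<integral>\<^sup>+x. F (a * x - b * y) (b * x + a * y) \<partial>lborel \<partial>lborel)"
    by (rule lborel_pair.Fubini') measurable
  also have "\<dots> = ennreal \<bar>1 / a\<bar> * (\<integral>\<^sup>+y. \<integral>\<^sup>+u. F u (b / a * u + 1 / a * y) \<partial>lborel \<partial>lborel)"
    unfolding inner by (rule nn_integral_cmult) measurable
  also have "\<dots> = ennreal \<bar>1 / a\<bar> * (\<integral>\<^sup>+u. \<integral>\<^sup>+y. F u (b / a * u + 1 / a * y) \<partial>lborel \<partial>lborel)"
    by (intro arg_cong[where f = "(*) _"] lborel_pair.Fubini') measurable
  also have "\<dots> = (\<integral>\<^sup>+u. ennreal \<bar>1 / a\<bar> * (\<integral>\<^sup>+y. F u (b / a * u + 1 / a * y) \<partial>lborel) \<partial>lborel)"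
    by (rule nn_integral_cmult[symmetric]) measurable
  also have "\<dots> = (\<integral>\<^sup>+u. \<integral>\<^sup>+y. F u y \<partial>lborel \<partial>lborel)"
    using False by (intro nn_integral_cong nn_integral_real_affine[symmetric]) simp_all
  finally show ?thesis .
next
  case True
  then have b: "\<bar>b\<bar> = 1"
    using ab by (simp add: abs_square_eq_1)
  then have nz: "b \<noteq> 0" by auto
  have inner: "(\<integral>\<^sup>+v. F u v \<partial>lborel) = (\<integral>\<^sup>+x. F u (b * x) \<partial>lborel)" for u
    using nn_integral_real_affine[of "F u" b 0] b nz by simp
  have "(\<integral>\<^sup>+u. \<integral>\<^sup>+v. F u v \<partial>lborel \<partial>lborel) = (\<integral>\<^sup>+u. \<integral>\<^sup>+x. F u (b * x) \<partial>lborel \<partial>lborel)"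
    by (simp only: inner)
  also have "\<dots> = (\<integral>\<^sup>+y. \<integral>\<^sup>+x. F (- b * y) (b * x) \<partial>lborel \<partial>lborel)"
    using b nz by (subst nn_integral_real_affine[where c = "- b" and t = 0]) auto
  also have "\<dots> = (\<integral>\<^sup>+x. \<integral>\<^sup>+y. F (- b * y) (b * x) \<partial>lborel \<partial>lborel)"
    by (rule lborel_pair.Fubini') measurable
  finally show ?thesis
    using True by simp
qed

text \<open>The law of each of the real and imaginary parts of a complex Gaussian with variance 1,
  which share that variance equally.\<close>

definition var_half_normal_law :: "real measure" where
  "var_half_normal_law = density lborel (\<lambda>x. ennreal (normal_density 0 (sqrt (1 / 2)) x))"

lemma sets_var_half_normal_law [simp, measurable_cong]: "sets var_half_normal_law = sets borel"
  by (simp add: var_half_normal_law_def)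

lemma space_var_half_normal_law [simp]: "space var_half_normal_law = UNIV"
  by (simp add: var_half_normal_law_def)

lemma prob_space_var_half_normal_law: "prob_space var_half_normal_law"
  unfolding var_half_normal_law_def by (rule prob_space_normal_density) simp

interpretation var_half_normal: prob_space var_half_normal_law
  by (rule prob_space_var_half_normal_law)

interpretation var_half_normal_pair: pair_sigma_finite var_half_normal_law var_half_normal_law
  by standard

lemma normal_density_half: "normal_density 0 (sqrt (1 / 2)) x = exp (- x\<^sup>2) / sqrt pi"
  by (simp add: normal_density_def)

text \<open>The joint density is radial, a function of \<open>x\<^sup>2 + y\<^sup>2\<close> alone.
  Both the rotation invariance and the law of the squared modulus rest on this form.\<close>

lemma nn_integral_var_half_normal_pair:
  assumes [measurable]: "case_prod F \<in> borel_measurable (borel \<Otimes>\<^sub>M borel)"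
  shows "(\<integral>\<^sup>+x. \<integral>\<^sup>+y. F x y \<partial>var_half_normal_law \<partial>var_half_normal_law)
       = (\<integral>\<^sup>+x. \<integral>\<^sup>+y. ennreal (exp (- (x\<^sup>2 + y\<^sup>2)) / pi) * F x y \<partial>lborel \<partial>lborel)"
proof -
  have e: "ennreal (exp (- x\<^sup>2) / sqrt pi) * (ennreal (exp (- y\<^sup>2) / sqrt pi) * c)
     = ennreal (exp (- (x\<^sup>2 + y\<^sup>2)) / pi) * c" for x y :: real and c
    by (simp add: mult.assoc[symmetric] ennreal_mult'[symmetric] exp_add[symmetric])
  show ?thesis
    unfolding var_half_normal_law_def normal_density_half
    by (simp add: nn_integral_density nn_integral_cmult[symmetric] e)
qed

text \<open>A rotation preserves the radial density, so the density can be absorbed into the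
  integrand and the invariance of Lebesgue measure applies.\<close>

lemma nn_integral_var_half_normal_rotation:
  assumes [measurable]: "case_prod F \<in> borel_measurable (borel \<Otimes>\<^sub>M borel)"
    and ab: "a\<^sup>2 + b\<^sup>2 = 1"
  shows "(\<integral>\<^sup>+x. \<integral>\<^sup>+y. F (a * x - b * y) (b * x + a * y) \<partial>var_half_normal_law \<partial>var_half_normal_law)
       = (\<integral>\<^sup>+x. \<integral>\<^sup>+y. F x y \<partial>var_half_normal_law \<partial>var_half_normal_law)"
proof -
  have e: "(a * x - b * y)\<^sup>2 + (b * x + a * y)\<^sup>2 = x\<^sup>2 + y\<^sup>2" for x y
  proof -
    have "(a * x - b * y)\<^sup>2 + (b * x + a * y)\<^sup>2 = (a\<^sup>2 + b\<^sup>2) * (x\<^sup>2 + y\<^sup>2)" by algebra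
    then show ?thesis using ab by simp
  qed
  show ?thesis
    using nn_integral_lborel_rotation[of "\<lambda>x y. ennreal (exp (- (x\<^sup>2 + y\<^sup>2)) / pi) * F x y", OF _ ab]
    unfolding e by (simp add: nn_integral_var_half_normal_pair)
qed

text \<open>Rotating by \<open>(a, - b)\<close> makes \<open>a * x + b * y\<close> the first
  coordinate; the second coordinate then integrates out to total mass 1.\<close>

lemma nn_integral_var_half_normal_sum:
  assumes [measurable]: "f \<in> borel_measurable borel" and ab: "a\<^sup>2 + b\<^sup>2 = 1"
  shows "(\<integral>\<^sup>+x. \<integral>\<^sup>+y. f (a * x + b * y) \<partial>var_half_normal_law \<partial>var_half_normal_law) = (\<integral>\<^sup>+x. f x \<partial>var_half_normal_law)"
  using nn_integral_var_half_normal_rotation[of "\<lambda>x y. f x" a "- b"] ab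
  by (simp add: var_half_normal.emeasure_space_1[simplified])

section \<open>Areas of discs in place of polar coordinates\<close>

text \<open>The disc of squared radius \<open>a\<close> has area \<open>pi * a\<close>, which is
  linear in \<open>a\<close>, so the image measure has constant density \<open>pi\<close>.
  Half-lines \<open>{..a}\<close> form an intersection-stable generator on which the two measures
  are compared.\<close>

lemma distr_lborel_sum_squares:
  "distr (lborel :: (real \<times> real) measure) borel (\<lambda>(x, y). x\<^sup>2 + y\<^sup>2)
     = density lborel (\<lambda>u. ennreal pi * indicator {0..} u)" (is "?L = ?R")
proof (rule measure_eqI_generator_eq)
  show "Int_stable (range (atMost :: real \<Rightarrow> _))"
    by (auto simp: Int_stable_def)
  show "range atMost \<subseteq> Pow (UNIV :: real set)" by simp
  have [measurable]: "(\<lambda>(x, y). x\<^sup>2 + y\<^sup>2 :: real) \<in> borel_measurable borel"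
    by (subst borel_prod[symmetric]) measurable
  have L: "emeasure ?L {..a} = ennreal pi * ennreal a" for a :: real
  proof (cases "a \<ge> 0")
    case True
    \<comment> \<open>The norm on pairs is Euclidean, so the preimage of \<open>{..a}\<close> is a
      closed ball of radius \<open>sqrt a\<close>.\<close>
    have "emeasure ?L {..a} = emeasure lborel (cball (0 :: real \<times> real) (sqrt a))"
      by (subst emeasure_distr)
        (auto simp: norm_prod_def real_sqrt_le_iff intro!: arg_cong[where f = "emeasure lborel"])
    also have "\<dots> = ennreal pi * ennreal a"
      using True by (simp add: emeasure_cball unit_ball_vol_2 ennreal_mult)
    finally show ?thesis .
  next
    case False
    then have "(\<lambda>(x, y). x\<^sup>2 + y\<^sup>2) -` {..a} = {}"
      by (auto simp: not_le) (smt (verit) zero_le_power2)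
    then show ?thesis using False by (simp add: emeasure_distr ennreal_neg)
  qed
  have R: "emeasure ?R {..a} = ennreal pi * ennreal a" for a :: real
  proof -
    have "emeasure ?R {..a} = (\<integral>\<^sup>+u. ennreal pi * indicator {0..a} u \<partial>lborel)"
      by (subst emeasure_density) (auto intro!: nn_integral_cong simp: indicator_def)
    then show ?thesis
      by (cases "a \<ge> 0") (simp_all add: nn_integral_cmult_indicator ennreal_neg)
  qed
  show "emeasure ?L X = emeasure ?R X" if "X \<in> range atMost" for X
    using that L R by auto
  show "sets ?L = sigma_sets UNIV (range atMost)" "sets ?R = sigma_sets UNIV (range atMost)"
    by (simp_all add: borel_eq_atMost)
  \<comment> \<open>Both measures are infinite, so uniqueness needs an exhaustion by generators of
    finite measure.\<close>
  show "range (\<lambda>n. {..real n}) \<subseteq> range atMost" by auto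
  show "(\<Union>n. {..real n}) = UNIV" by (auto intro: real_arch_simple)
  show "emeasure ?L {..real n} \<noteq> \<infinity>" for n
    unfolding L by (simp add: ennreal_mult_eq_top_iff)
qed

section \<open>The standard complex Gaussian law\<close>

definition complex_normal_law :: "complex measure" where
  "complex_normal_law = distr (var_half_normal_law \<Otimes>\<^sub>M var_half_normal_law) borel (\<lambda>(x, y). Complex x y)"

lemma measurable_Complex [measurable (raw)]:
  assumes [measurable]: "f \<in> borel_measurable M" "g \<in> borel_measurable M"
  shows "(\<lambda>x. Complex (f x) (g x)) \<in> borel_measurable M"
  unfolding Complex_eq by measurable

lemma sets_complex_normal_law [simp, measurable_cong]: "sets complex_normal_law = sets borel"
  by (simp add: complex_normal_law_def)

lemma prob_space_complex_normal_law: "prob_space complex_normal_law"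
proof -
  interpret pair_prob_space var_half_normal_law var_half_normal_law by standard
  show ?thesis unfolding complex_normal_law_def
    by (rule prob_space_distr) measurable
qed

interpretation complex_normal: prob_space complex_normal_law
  by (rule prob_space_complex_normal_law)

interpretation complex_normal_pair: pair_sigma_finite complex_normal_law complex_normal_law
  by standard

lemma nn_integral_complex_normal:
  assumes [measurable]: "f \<in> borel_measurable borel"
  shows "(\<integral>\<^sup>+z. f z \<partial>complex_normal_law)
     = (\<integral>\<^sup>+x. \<integral>\<^sup>+y. f (Complex x y) \<partial>var_half_normal_law \<partial>var_half_normal_law)"
  unfolding complex_normal_law_def
  by (subst nn_integral_distr)
    (simp_all add: var_half_normal.nn_integral_fst[symmetric] case_prod_beta)

text \<open>Circular symmetry: the phase \<open>g / cmod g\<close> acts as a rotation of the plane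
  and leaves the law unchanged, so only the modulus of the factor matters.\<close>

lemma nn_integral_complex_normal_mult:
  assumes [measurable]: "f \<in> borel_measurable borel"
  shows "(\<integral>\<^sup>+z. f (g * z) \<partial>complex_normal_law) = (\<integral>\<^sup>+z. f (of_real (cmod g) * z) \<partial>complex_normal_law)"
proof (cases "g = 0")
  case False
  define a where "a = Re g / cmod g"
  define b where "b = Im g / cmod g"
  have ab: "a\<^sup>2 + b\<^sup>2 = 1"
    using False by (simp add: a_def b_def power_divide add_divide_distrib[symmetric] cmod_power2[symmetric])
  have e: "g * Complex x y = of_real (cmod g) * Complex (a * x - b * y) (b * x + a * y)" for x y
    using False by (simp add: complex_eq_iff a_def b_def field_simps)
  show ?thesis
    using nn_integral_var_half_normal_rotation[of "\<lambda>x y. f (of_real (cmod g) * Complex x y)", OF _ ab]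
    by (simp add: nn_integral_complex_normal e)
qed simp

text \<open>Variances of independent Gaussians add. After dividing the weights by
  \<open>sqrt (s\<^sup>2 + t\<^sup>2)\<close>, the real parts and the imaginary parts are each
  combined by the one-dimensional sum rule.\<close>

lemma nn_integral_complex_normal_sum:
  fixes s t :: real
  assumes [measurable]: "f \<in> borel_measurable borel"
  shows "(\<integral>\<^sup>+z. \<integral>\<^sup>+w. f (of_real s * z + of_real t * w) \<partial>complex_normal_law \<partial>complex_normal_law)
       = (\<integral>\<^sup>+z. f (of_real (sqrt (s\<^sup>2 + t\<^sup>2)) * z) \<partial>complex_normal_law)"
proof (cases "s\<^sup>2 + t\<^sup>2 = 0")
  \<comment> \<open>Both weights vanish and normalizing would divide by zero; both sides equal
    \<open>f 0\<close>, since the law has total mass 1.\<close>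
  case True
  then show ?thesis
    by (simp add: sum_power2_eq_zero_iff complex_normal.emeasure_space_1)
next
  case False
  define r where "r = sqrt (s\<^sup>2 + t\<^sup>2)"
  have "r > 0" using False by (simp add: r_def sum_power2_gt_zero_iff sum_power2_eq_zero_iff)
  define a where "a = s / r"
  define b where "b = t / r"
  have st: "s = r * a" "t = r * b" using \<open>r > 0\<close> by (auto simp: a_def b_def)
  have ab: "a\<^sup>2 + b\<^sup>2 = 1"
    using \<open>r > 0\<close> by (simp add: a_def b_def power_divide add_divide_distrib[symmetric]) (simp add: r_def sum_power2_eq_zero_iff)
  have e: "of_real s * Complex x1 y1 + of_real t * Complex x2 y2
     = of_real r * Complex (a * x1 + b * x2) (a * y1 + b * y2)" for x1 y1 x2 y2
    unfolding st by (simp add: complex_eq_iff algebra_simps)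
  let ?N = var_half_normal_law
  have "(\<integral>\<^sup>+z. \<integral>\<^sup>+w. f (of_real s * z + of_real t * w) \<partial>complex_normal_law \<partial>complex_normal_law)
    = (\<integral>\<^sup>+x1. \<integral>\<^sup>+y1. \<integral>\<^sup>+x2. \<integral>\<^sup>+y2. f (of_real r * Complex (a * x1 + b * x2) (a * y1 + b * y2))
        \<partial>?N \<partial>?N \<partial>?N \<partial>?N)"
    by (simp add: nn_integral_complex_normal e)
  \<comment> \<open>Exchanging \<open>y1\<close> and \<open>x2\<close> puts the two real parts next
    to each other, and likewise the two imaginary parts.\<close>
  also have "\<dots> = (\<integral>\<^sup>+x1. \<integral>\<^sup>+x2. \<integral>\<^sup>+y1. \<integral>\<^sup>+y2. f (of_real r * Complex (a * x1 + b * x2) (a * y1 + b * y2))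
        \<partial>?N \<partial>?N \<partial>?N \<partial>?N)"
    by (intro nn_integral_cong var_half_normal_pair.Fubini') measurable
  also have "\<dots> = (\<integral>\<^sup>+x1. \<integral>\<^sup>+x2. \<integral>\<^sup>+y. f (of_real r * Complex (a * x1 + b * x2) y) \<partial>?N \<partial>?N \<partial>?N)"
    by (intro nn_integral_cong nn_integral_var_half_normal_sum[OF _ ab]) measurable
  also have "\<dots> = (\<integral>\<^sup>+x. \<integral>\<^sup>+y. f (of_real r * Complex x y) \<partial>?N \<partial>?N)"
    by (rule nn_integral_var_half_normal_sum[OF _ ab]) measurable
  finally show ?thesis
    by (simp add: nn_integral_complex_normal r_def)
qed

text \<open>The radial density \<open>exp (- u) / pi\<close> meets the image measure
  \<open>pi du\<close> of the squared radius, and the constants cancel: the squared modulus is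
  exponential with mean 1.\<close>

lemma nn_integral_complex_normal_cmod_squared:
  assumes [measurable]: "f \<in> borel_measurable borel"
  shows "(\<integral>\<^sup>+z. f ((cmod z)\<^sup>2) \<partial>complex_normal_law)
     = (\<integral>\<^sup>+u. ennreal (exp (- u)) * f u * indicator {0<..} u \<partial>lborel)"
proof -
  have [measurable]: "(\<lambda>(x, y). x\<^sup>2 + y\<^sup>2 :: real) \<in> borel_measurable borel"
    by (subst borel_prod[symmetric]) measurable
  have "(\<integral>\<^sup>+z. f ((cmod z)\<^sup>2) \<partial>complex_normal_law)
     = (\<integral>\<^sup>+x. \<integral>\<^sup>+y. ennreal (exp (- (x\<^sup>2 + y\<^sup>2)) / pi) * f (x\<^sup>2 + y\<^sup>2) \<partial>lborel \<partial>lborel)"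
    by (simp add: nn_integral_complex_normal nn_integral_var_half_normal_pair cmod_power2)
  also have "\<dots> = (\<integral>\<^sup>+p. (\<lambda>u. ennreal (exp (- u) / pi) * f u) (case p of (x, y) \<Rightarrow> x\<^sup>2 + y\<^sup>2)
      \<partial>(lborel :: (real \<times> real) measure))"
    unfolding lborel_prod[symmetric] by (subst lborel.nn_integral_fst[symmetric]) auto
  also have "\<dots> = (\<integral>\<^sup>+u. ennreal (exp (- u) / pi) * f u
      \<partial>distr (lborel :: (real \<times> real) measure) borel (\<lambda>(x, y). x\<^sup>2 + y\<^sup>2))"
    by (subst nn_integral_distr) auto
  also have "\<dots> = (\<integral>\<^sup>+u. ennreal (exp (- u)) * f u * indicator {0..} u \<partial>lborel)"
  proof -
    have e: "ennreal pi * (ennreal (exp (- u) / pi) * c) = ennreal (exp (- u)) * c" for u :: real and c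
      by (simp add: mult.assoc[symmetric] ennreal_mult'[symmetric])
    show ?thesis
      unfolding distr_lborel_sum_squares
      by (subst nn_integral_density) (auto intro!: nn_integral_cong simp: e split: split_indicator)
  qed
  \<comment> \<open>The endpoint 0 is a null set; removing it matches the open half-line on which
    the SNR density is positive.\<close>
  also have "\<dots> = (\<integral>\<^sup>+u. ennreal (exp (- u)) * f u * indicator {0<..} u \<partial>lborel)"
    by (intro nn_integral_cong_AE) (use AE_lborel_singleton[of 0] in \<open>auto split: split_indicator\<close>)
  finally show ?thesis .
qed

text \<open>Independence of the real and imaginary parts makes their joint law the product measure
  from which \<open>complex_normal_law\<close> is built.\<close>

lemma (in prob_space) distr_circ_sym_gaussian:
  assumes "circ_sym_gaussian G 1"
  shows "distr M borel G = complex_normal_law"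
proof -
  from assms have [measurable]: "random_variable borel G"
    and d: "distr M lborel (\<lambda>\<omega>. Re (G \<omega>)) = var_half_normal_law"
      "distr M lborel (\<lambda>\<omega>. Im (G \<omega>)) = var_half_normal_law"
    and i: "indep_var borel (\<lambda>\<omega>. Re (G \<omega>)) borel (\<lambda>\<omega>. Im (G \<omega>))"
    by (auto simp: circ_sym_gaussian_def distributed_def var_half_normal_law_def)
  have d': "distr M borel (\<lambda>\<omega>. Re (G \<omega>)) = var_half_normal_law" "distr M borel (\<lambda>\<omega>. Im (G \<omega>)) = var_half_normal_law"
    using d by (simp_all cong: distr_cong)
  have "var_half_normal_law \<Otimes>\<^sub>M var_half_normal_law = distr M (borel \<Otimes>\<^sub>M borel) (\<lambda>\<omega>. (Re (G \<omega>), Im (G \<omega>)))"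
    using i unfolding indep_var_distribution_eq d' by simp
  then show ?thesis
    by (simp add: complex_normal_law_def distr_distr comp_def)
qed

section \<open>From the channel to iterated integrals\<close>

context sosf_channel
begin

lemma measurable_gaussian [measurable]:
  "random_variable borel G\<^sub>1" "random_variable borel G\<^sub>2" "random_variable borel G\<^sub>3"
  using gaussian by (simp_all add: circ_sym_gaussian_def)

text \<open>Independence turns the joint law into a product measure. Placing
  \<open>G\<^sub>3\<close> outermost corresponds to conditioning on it.\<close>

lemma nn_integral_gaussians:
  assumes [measurable]: "(\<lambda>(x, y, z). h x y z) \<in> borel_measurable (borel \<Otimes>\<^sub>M borel \<Otimes>\<^sub>M borel)"
  shows "(\<integral>\<^sup>+\<omega>. h (G\<^sub>1 \<omega>) (G\<^sub>2 \<omega>) (G\<^sub>3 \<omega>) \<partial>M)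
    = (\<integral>\<^sup>+z. \<integral>\<^sup>+y. \<integral>\<^sup>+x. h x y z \<partial>complex_normal_law \<partial>complex_normal_law \<partial>complex_normal_law)"
proof -
  \<comment> \<open>Position 0 belongs to the real-valued phase, so a complex placeholder fills it
    and \<open>I\<close> leaves this index out.\<close>
  define X where "X = (\<lambda>i::nat. [G\<^sub>1, G\<^sub>1, G\<^sub>2, G\<^sub>3] ! i)"
  \<comment> \<open>Written in this order, repeated removal of the first inserted index peels off 3,
    then 2, and leaves the singleton of 1.\<close>
  define I where "I = {3, 2, 1::nat}"
  have X: "X 1 = G\<^sub>1" "X 2 = G\<^sub>2" "X 3 = G\<^sub>3" "X (Suc 0) = G\<^sub>1"
    by (simp_all add: X_def numeral_2_eq_2 numeral_3_eq_3)
  have rv: "random_variable borel (X i)" if "i \<in> I" for i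
    using that by (auto simp: I_def X)
  have "indep_sets (\<lambda>i. [generated_events \<phi>, generated_events G\<^sub>1,
               generated_events G\<^sub>2, generated_events G\<^sub>3] ! i) I"
    by (rule indep_sets_mono_index[OF _ mutually_indep]) (auto simp: I_def)
  also have "?this \<longleftrightarrow> indep_sets (\<lambda>i. {X i -` A \<inter> space M | A. A \<in> sets borel}) I"
    by (rule indep_sets_cong[OF refl], unfold I_def X_def generated_events_def, elim insertE)
      (simp_all add: numeral_2_eq_2 numeral_3_eq_3)
  finally have "indep_vars (\<lambda>_. borel) X I"
    using rv by (simp add: indep_vars_def2)
  then have "distr M (\<Pi>\<^sub>M i\<in>I. borel) (\<lambda>x. \<lambda>i\<in>I. X i x) = (\<Pi>\<^sub>M i\<in>I. distr M borel (X i))"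
    using rv by (subst (asm) indep_vars_iff_distr_eq_PiM') (auto simp: I_def)
  also have "\<dots> = (\<Pi>\<^sub>M i\<in>I. complex_normal_law)"
    by (intro PiM_cong) (auto simp: I_def X distr_circ_sym_gaussian gaussian)
  finally have joint: "distr M (\<Pi>\<^sub>M i\<in>I. borel) (\<lambda>x. \<lambda>i\<in>I. X i x) = (\<Pi>\<^sub>M i\<in>I. complex_normal_law)" .
  have [measurable]: "(\<lambda>x. \<lambda>i\<in>I. X i x) \<in> measurable M (\<Pi>\<^sub>M i\<in>I. borel)"
    by (intro measurable_restrict rv)
  have I: "1 \<in> I" "2 \<in> I" "3 \<in> I" by (auto simp: I_def)
  have hI: "(\<lambda>v. h (v 1) (v 2) (v 3)) \<in> borel_measurable (\<Pi>\<^sub>M i\<in>I. borel)"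
  proof -
    have [measurable]: "(\<lambda>v. v 1) \<in> borel_measurable (\<Pi>\<^sub>M i\<in>I. borel)"
      "(\<lambda>v. v 2) \<in> borel_measurable (\<Pi>\<^sub>M i\<in>I. borel)"
      "(\<lambda>v. v 3) \<in> borel_measurable (\<Pi>\<^sub>M i\<in>I. borel)"
      using I by (auto intro: measurable_component_singleton)
    have "(\<lambda>v. (\<lambda>(x, y, z). h x y z) (v 1, v 2, v 3)) \<in> borel_measurable (\<Pi>\<^sub>M i\<in>I. borel)"
      by measurable
    then show ?thesis by simp
  qed
  have sI: "sets (\<Pi>\<^sub>M i\<in>I. complex_normal_law) = sets (\<Pi>\<^sub>M i\<in>I. borel)" for I :: "nat set"
    by (intro sets_PiM_cong) auto
  interpret P: product_sigma_finite "\<lambda>_::nat. complex_normal_law"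
    by standard
  have "(\<integral>\<^sup>+\<omega>. h (G\<^sub>1 \<omega>) (G\<^sub>2 \<omega>) (G\<^sub>3 \<omega>) \<partial>M)
     = (\<integral>\<^sup>+v. h (v 1) (v 2) (v 3) \<partial>distr M (\<Pi>\<^sub>M i\<in>I. borel) (\<lambda>x. \<lambda>i\<in>I. X i x))"
    by (subst nn_integral_distr) (use hI I in \<open>simp_all add: X\<close>)
  also have "\<dots> = (\<integral>\<^sup>+v. h (v 1) (v 2) (v 3) \<partial>(\<Pi>\<^sub>M i\<in>I. complex_normal_law))"
    by (simp only: joint)
  also have "\<dots> = (\<integral>\<^sup>+z. \<integral>\<^sup>+v. h (v 1) (v 2) z \<partial>(\<Pi>\<^sub>M i\<in>{2, 1::nat}. complex_normal_law) \<partial>complex_normal_law)"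
    unfolding I_def
    by (subst P.product_nn_integral_insert_rev)
      (use hI in \<open>auto simp: I_def measurable_cong_sets[OF sI refl]\<close>)
  also have "\<dots> = (\<integral>\<^sup>+z. \<integral>\<^sup>+y. \<integral>\<^sup>+v. h (v 1) y z \<partial>(\<Pi>\<^sub>M i\<in>{1::nat}. complex_normal_law) \<partial>complex_normal_law \<partial>complex_normal_law)"
  proof (intro nn_integral_cong)
    fix z
    have [measurable]: "(\<lambda>v. v 1) \<in> borel_measurable (\<Pi>\<^sub>M i\<in>{2, 1::nat}. complex_normal_law)"
      "(\<lambda>v. v 2) \<in> borel_measurable (\<Pi>\<^sub>M i\<in>{2, 1::nat}. complex_normal_law)"
      unfolding measurable_cong_sets[OF sI refl] by (rule measurable_component_singleton, simp)+
    have "(\<lambda>v. (\<lambda>(x, y, z). h x y z) (v 1, v 2, z)) \<in> borel_measurable (\<Pi>\<^sub>M i\<in>{2, 1::nat}. complex_normal_law)"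
      by measurable
    then show "(\<integral>\<^sup>+v. h (v 1) (v 2) z \<partial>(\<Pi>\<^sub>M i\<in>{2, 1::nat}. complex_normal_law))
      = (\<integral>\<^sup>+y. \<integral>\<^sup>+v. h (v 1) y z \<partial>(\<Pi>\<^sub>M i\<in>{1::nat}. complex_normal_law) \<partial>complex_normal_law)"
      by (subst P.product_nn_integral_insert_rev) auto
  qed
  also have "\<dots> = (\<integral>\<^sup>+z. \<integral>\<^sup>+y. \<integral>\<^sup>+x. h x y z \<partial>complex_normal_law \<partial>complex_normal_law \<partial>complex_normal_law)"
  proof (intro nn_integral_cong)
    fix z y
    have "(\<lambda>x. (\<lambda>(x, y, z). h x y z) (x, y, z)) \<in> borel_measurable complex_normal_law"
      by measurable
    then show "(\<integral>\<^sup>+v. h (v 1) y z \<partial>(\<Pi>\<^sub>M i\<in>{1::nat}. complex_normal_law))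
       = (\<integral>\<^sup>+x. h x y z \<partial>complex_normal_law)"
      using P.product_nn_integral_singleton[of "\<lambda>x. h x y z" 1] by simp
  qed
  finally show ?thesis .
qed

text \<open>Here \<open>r\<close> stands for the squared modulus of \<open>G\<^sub>3\<close>. Given
  it, the signal is Gaussian with variance
  \<open>\<omega>\<^sub>1\<^sup>2 + \<omega>\<^sub>2\<^sup>2 * r\<close>, so its squared modulus is
  this variance times an exponential variable \<open>u\<close> of mean 1.\<close>

lemma nn_integral_sosf_signal:
  assumes "\<omega>\<^sub>0 = 0" and [measurable]: "f \<in> borel_measurable borel"
  shows "(\<integral>\<^sup>+\<omega>. f ((cmod (sosf_signal \<omega>\<^sub>0 \<omega>\<^sub>1 \<omega>\<^sub>2 \<phi> G\<^sub>1 G\<^sub>2 G\<^sub>3 \<omega>))\<^sup>2) \<partial>M)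
    = (\<integral>\<^sup>+r. \<integral>\<^sup>+u. ennreal (exp (- r)) * ennreal (exp (- u)) * f ((\<omega>\<^sub>1\<^sup>2 + \<omega>\<^sub>2\<^sup>2 * r) * u)
         * indicator {0<..} u * indicator {0<..} r \<partial>lborel \<partial>lborel)"
proof -
  let ?C = complex_normal_law
  have inner: "(\<integral>\<^sup>+y. \<integral>\<^sup>+x. f ((cmod (of_real \<omega>\<^sub>1 * x + of_real \<omega>\<^sub>2 * y * z))\<^sup>2) \<partial>?C \<partial>?C)
    = (\<integral>\<^sup>+x. f ((\<omega>\<^sub>1\<^sup>2 + \<omega>\<^sub>2\<^sup>2 * (cmod z)\<^sup>2) * (cmod x)\<^sup>2) \<partial>?C)" for z
  proof -
    have "(\<integral>\<^sup>+y. \<integral>\<^sup>+x. f ((cmod (of_real \<omega>\<^sub>1 * x + of_real \<omega>\<^sub>2 * y * z))\<^sup>2) \<partial>?C \<partial>?C)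
      = (\<integral>\<^sup>+x. \<integral>\<^sup>+y. f ((cmod (of_real \<omega>\<^sub>1 * x + of_real \<omega>\<^sub>2 * (z * y)))\<^sup>2) \<partial>?C \<partial>?C)"
      by (subst complex_normal_pair.Fubini') (simp_all add: mult_ac)
    \<comment> \<open>Circular symmetry of \<open>y\<close> discards the phase of \<open>z\<close>;
      the weights are now real and the sum rule applies.\<close>
    also have "\<dots> = (\<integral>\<^sup>+x. \<integral>\<^sup>+y. f ((cmod (of_real \<omega>\<^sub>1 * x + of_real \<omega>\<^sub>2 * (of_real (cmod z) * y)))\<^sup>2) \<partial>?C \<partial>?C)"
      by (intro nn_integral_cong nn_integral_complex_normal_mult) measurable
    also have "\<dots> = (\<integral>\<^sup>+x. f ((cmod (of_real (sqrt (\<omega>\<^sub>1\<^sup>2 + (\<omega>\<^sub>2 * cmod z)\<^sup>2)) * x))\<^sup>2) \<partial>?C)"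
      by (subst nn_integral_complex_normal_sum[symmetric]) (simp_all add: mult_ac)
    also have "\<dots> = (\<integral>\<^sup>+x. f ((\<omega>\<^sub>1\<^sup>2 + \<omega>\<^sub>2\<^sup>2 * (cmod z)\<^sup>2) * (cmod x)\<^sup>2) \<partial>?C)"
      by (simp add: norm_mult power_mult_distrib)
    finally show ?thesis .
  qed
  have "(\<integral>\<^sup>+\<omega>. f ((cmod (sosf_signal \<omega>\<^sub>0 \<omega>\<^sub>1 \<omega>\<^sub>2 \<phi> G\<^sub>1 G\<^sub>2 G\<^sub>3 \<omega>))\<^sup>2) \<partial>M)
    = (\<integral>\<^sup>+z. \<integral>\<^sup>+y. \<integral>\<^sup>+x. f ((cmod (of_real \<omega>\<^sub>1 * x + of_real \<omega>\<^sub>2 * y * z))\<^sup>2) \<partial>?C \<partial>?C \<partial>?C)"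
    using assms(1) by (subst nn_integral_gaussians[symmetric]) (simp_all add: sosf_signal_def)
  also have "\<dots> = (\<integral>\<^sup>+z. \<integral>\<^sup>+u. ennreal (exp (- u)) * f ((\<omega>\<^sub>1\<^sup>2 + \<omega>\<^sub>2\<^sup>2 * (cmod z)\<^sup>2) * u) * indicator {0<..} u \<partial>lborel \<partial>?C)"
    unfolding inner by (intro nn_integral_cong nn_integral_complex_normal_cmod_squared) measurable
  also have "\<dots> = (\<integral>\<^sup>+r. ennreal (exp (- r))
      * (\<integral>\<^sup>+u. ennreal (exp (- u)) * f ((\<omega>\<^sub>1\<^sup>2 + \<omega>\<^sub>2\<^sup>2 * r) * u) * indicator {0<..} u \<partial>lborel)
      * indicator {0<..} r \<partial>lborel)"
    by (rule nn_integral_complex_normal_cmod_squared) measurable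
  also have "\<dots> = (\<integral>\<^sup>+r. \<integral>\<^sup>+u. ennreal (exp (- r)) * ennreal (exp (- u)) * f ((\<omega>\<^sub>1\<^sup>2 + \<omega>\<^sub>2\<^sup>2 * r) * u)
         * indicator {0<..} u * indicator {0<..} r \<partial>lborel \<partial>lborel)"
    by (simp add: nn_integral_cmult[symmetric] nn_integral_multc[symmetric] mult.assoc)
  finally show ?thesis .
qed

end

section \<open>The generalized incomplete gamma function and mixtures of exponentials\<close>

text \<open>The Bochner integral in \<open>gen_inc_Gamma\<close> would default to 0 without
  integrability. The integrand is therefore dominated by \<open>exp (- t) / b\<close>, which also
  controls the factor \<open>1 / t\<close> near 0 when \<open>x = 0\<close>.\<close>

lemma ennreal_gen_inc_Gamma_0:
  assumes "b > 0" "x \<ge> 0"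
  shows "ennreal (gen_inc_Gamma 0 x b)
    = (\<integral>\<^sup>+t. ennreal (exp (- t) * exp (- b / t) / t) * indicator {x<..} t \<partial>lborel)"
proof -
  let ?g = "\<lambda>t::real. exp (- t) * exp (- b / t) / t * indicator {x<..} t"
  have eq: "indicator {x<..} t *\<^sub>R (t powr (0 - 1) * exp (- t) * exp (- b / t)) = ?g t" for t :: real
    using assms by (auto simp: powr_minus_divide split: split_indicator)
  have "(\<integral>\<^sup>+t. ennreal (exp (- t) * indicator {0..} t) \<partial>lborel) = 1"
    using nn_intergal_power_times_exp_Ici[of 0]
    by (auto intro!: nn_integral_cong split: split_indicator elim!: trans[rotated])
  then have dom: "integrable lborel (\<lambda>t::real. exp (- t) * indicator {0..} t / b)"
    by (intro integrable_divide_zero integrableI_nn_integral_finite[where x = 1]) auto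
  have "integrable lborel ?g"
  proof (rule Bochner_Integration.integrable_bound[OF dom])
    show "AE t in lborel. norm (?g t) \<le> norm (exp (- t) * indicator {0..} t / b)"
    proof (intro AE_I2)
      fix t :: real
      show "norm (?g t) \<le> norm (exp (- t) * indicator {0..} t / b)"
      proof (cases "t > x")
        case True
        then have "t > 0" using assms by simp
        \<comment> \<open>This bounds \<open>exp (- b / t) / t\<close> by \<open>1 / b\<close>,
          uniformly in \<open>t > 0\<close>.\<close>
        have "b / t \<le> exp (b / t)" using exp_ge_add_one_self[of "b / t"] by linarith
        then have "exp (- b / t) / t \<le> 1 / b"
          using \<open>t > 0\<close> assms by (simp add: exp_minus field_simps)
        then have "exp (- t) * (exp (- b / t) / t) \<le> exp (- t) * (1 / b)"
          by (intro mult_left_mono) auto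
        then show ?thesis using True \<open>t > 0\<close> assms by simp
      qed simp
    qed
  qed measurable
  then have "ennreal (LINT t|lborel. ?g t) = (\<integral>\<^sup>+t. ennreal (?g t) \<partial>lborel)"
    using assms by (intro nn_integral_eq_integral[symmetric]) (auto split: split_indicator)
  also have "(\<integral>\<^sup>+t. ennreal (?g t) \<partial>lborel)
    = (\<integral>\<^sup>+t. ennreal (exp (- t) * exp (- b / t) / t) * indicator {x<..} t \<partial>lborel)"
    by (intro nn_integral_cong) (auto split: split_indicator)
  finally show ?thesis
    unfolding gen_inc_Gamma_def set_lebesgue_integral_def eq .
qed

text \<open>The substitution \<open>y = k * u\<close>: scaling an exponential variable of mean 1 by
  \<open>k\<close> gives one of mean \<open>k\<close>.\<close>

lemma nn_integral_exponential_scale: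
  fixes f :: "real \<Rightarrow> ennreal"
  assumes [measurable]: "f \<in> borel_measurable borel" and "k > 0"
  shows "(\<integral>\<^sup>+u. ennreal (exp (- u)) * f (k * u) * indicator {0<..} u \<partial>lborel)
    = (\<integral>\<^sup>+y. ennreal (exp (- y / k) / k) * f y * indicator {0<..} y \<partial>lborel)"
proof -
  have e: "ennreal k * (ennreal (exp (- u) / k) * c) = ennreal (exp (- u)) * c" for u :: real and c
    using \<open>k > 0\<close> by (simp add: mult.assoc[symmetric] ennreal_mult'[symmetric])
  have "(\<integral>\<^sup>+y. ennreal (exp (- y / k) / k) * f y * indicator {0<..} y \<partial>lborel)
    = ennreal k * (\<integral>\<^sup>+u. ennreal (exp (- u) / k) * f (k * u) * indicator {0<..} (k * u) \<partial>lborel)"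
    using \<open>k > 0\<close> by (subst nn_integral_real_affine[where c = k and t = 0]) simp_all
  also have "\<dots> = (\<integral>\<^sup>+u. ennreal k * (ennreal (exp (- u) / k) * f (k * u) * indicator {0<..} (k * u)) \<partial>lborel)"
    by (rule nn_integral_cmult[symmetric]) measurable
  also have "\<dots> = (\<integral>\<^sup>+u. ennreal (exp (- u)) * f (k * u) * indicator {0<..} u \<partial>lborel)"
    using \<open>k > 0\<close> by (intro nn_integral_cong) (auto simp: e zero_less_mult_iff split: split_indicator)
  finally show ?thesis ..
qed

text \<open>Substitute \<open>t = x + r\<close>. Then \<open>exp (- r) = exp x * exp (- t)\<close>
  yields the factor \<open>exp x\<close>, and the mean \<open>s * t\<close> yields both
  \<open>1 / s\<close> and the parameter \<open>y / s\<close>. Positivity of \<open>y\<close>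
  secures convergence even at \<open>x = 0\<close>.\<close>

lemma nn_integral_exponential_mixture:
  assumes "s > 0" "x \<ge> 0" "y > 0"
  shows "(\<integral>\<^sup>+r. ennreal (exp (- r)) * ennreal (exp (- y / (s * (x + r))) / (s * (x + r)))
        * indicator {0<..} r \<partial>lborel)
    = ennreal (1 / s * exp x * gen_inc_Gamma 0 x (y / s))"
proof -
  have nn: "gen_inc_Gamma 0 x (y / s) \<ge> 0"
    unfolding gen_inc_Gamma_def set_lebesgue_integral_def
    by (intro Bochner_Integration.integral_nonneg) auto
  have "ennreal (1 / s * exp x * gen_inc_Gamma 0 x (y / s))
    = ennreal (1 / s * exp x)
      * (\<integral>\<^sup>+t. ennreal (exp (- t) * exp (- (y / s) / t) / t) * indicator {x<..} t \<partial>lborel)"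
    using assms nn by (subst ennreal_mult) (auto simp: ennreal_gen_inc_Gamma_0)
  also have "\<dots> = (\<integral>\<^sup>+t. ennreal (1 / s * exp x)
      * (ennreal (exp (- t) * exp (- (y / s) / t) / t) * indicator {x<..} t) \<partial>lborel)"
    by (rule nn_integral_cmult[symmetric]) measurable
  also have "\<dots> = (\<integral>\<^sup>+r. ennreal (1 / s * exp x)
      * (ennreal (exp (- (x + r)) * exp (- (y / s) / (x + r)) / (x + r)) * indicator {x<..} (x + r)) \<partial>lborel)"
    by (subst nn_integral_real_affine[where c = 1 and t = x]) simp_all
  also have "\<dots> = (\<integral>\<^sup>+r. ennreal (exp (- r)) * ennreal (exp (- y / (s * (x + r))) / (s * (x + r)))
        * indicator {0<..} r \<partial>lborel)"
  proof (intro nn_integral_cong)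
    fix r :: real
    have "exp (- r) = exp x * exp (- (x + r))"
      by (simp add: exp_add[symmetric])
    then have "1 / s * exp x * (exp (- (x + r)) * exp (- (y / s) / (x + r)) / (x + r))
      = exp (- r) * (exp (- y / (s * (x + r))) / (s * (x + r)))"
      by simp
    then show "ennreal (1 / s * exp x)
        * (ennreal (exp (- (x + r)) * exp (- (y / s) / (x + r)) / (x + r)) * indicator {x<..} (x + r))
      = ennreal (exp (- r)) * ennreal (exp (- y / (s * (x + r))) / (s * (x + r))) * indicator {0<..} r"
      using assms by (auto simp: ennreal_mult'[symmetric] simp del: times_divide_eq_left times_divide_eq_right split: split_indicator)
  qed
  finally show ?thesis ..
qed

section \<open>The density of the SNR\<close>

theorem mainTheorem7:
  fixes M :: "'a measure"
    and \<omega>\<^sub>0 \<omega>\<^sub>1 \<omega>\<^sub>2 \<alpha> \<beta> avg :: real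
    and \<phi> :: "'a \<Rightarrow> real"
    and G\<^sub>1 G\<^sub>2 G\<^sub>3 :: "'a \<Rightarrow> complex"
  assumes "avg > 0"
    and "0 < \<alpha>" and "\<alpha> \<le> 1"
    and "sosf_channel M \<omega>\<^sub>0 \<omega>\<^sub>1 \<omega>\<^sub>2 \<phi> G\<^sub>1 G\<^sub>2 G\<^sub>3"
    and "\<alpha> = \<omega>\<^sub>2\<^sup>2" and "\<beta> = \<omega>\<^sub>0\<^sup>2" and "\<beta> = 0"
  shows "distributed M lborel
           (instantaneous_snr avg (sosf_signal \<omega>\<^sub>0 \<omega>\<^sub>1 \<omega>\<^sub>2 \<phi> G\<^sub>1 G\<^sub>2 G\<^sub>3))
           (\<lambda>\<gamma>. if \<gamma> > 0
                then ennreal (1 / (\<alpha> * avg) * exp ((1 - \<alpha>) / \<alpha>)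
                              * gen_inc_Gamma 0 ((1 - \<alpha>) / \<alpha>) (\<gamma> / (\<alpha> * avg)))
                else 0)"
proof -
  interpret sosf_channel M \<omega>\<^sub>0 \<omega>\<^sub>1 \<omega>\<^sub>2 \<phi> G\<^sub>1 G\<^sub>2 G\<^sub>3 by fact
  have \<omega>\<^sub>0: "\<omega>\<^sub>0 = 0" and \<omega>\<^sub>1: "\<omega>\<^sub>1\<^sup>2 = 1 - \<alpha>"
    using assms(5-7) normalized by auto
  \<comment> \<open>With these values the conditional mean of the SNR given \<open>r\<close> becomes
    \<open>s * (x + r)\<close>, so \<open>x\<close> is the future lower limit of the gamma
    integral.\<close>
  define s where "s = \<alpha> * avg"
  define x where "x = (1 - \<alpha>) / \<alpha>"
  have s: "s > 0" and x: "x \<ge> 0"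
    using assms by (simp_all add: s_def x_def)
  have scale: "avg * (\<omega>\<^sub>1\<^sup>2 + \<omega>\<^sub>2\<^sup>2 * r) = s * (x + r)" for r
    using assms(2) by (simp add: \<omega>\<^sub>1 assms(5)[symmetric] s_def x_def field_simps)
  let ?X = "instantaneous_snr avg (sosf_signal \<omega>\<^sub>0 \<omega>\<^sub>1 \<omega>\<^sub>2 \<phi> G\<^sub>1 G\<^sub>2 G\<^sub>3)"
  \<comment> \<open>Keeping the density as a mixture integral makes measurability and the later
    exchange of integrals immediate; \<open>p_eq\<close> gives the closed form.\<close>
  define p where "p = (\<lambda>y. (\<integral>\<^sup>+r. ennreal (exp (- r)) * ennreal (exp (- y / (s * (x + r))) / (s * (x + r)))
        * indicator {0<..} r \<partial>lborel) * indicator {0<..} y)"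
  have p_eq: "p = (\<lambda>\<gamma>. if \<gamma> > 0
                then ennreal (1 / (\<alpha> * avg) * exp ((1 - \<alpha>) / \<alpha>)
                              * gen_inc_Gamma 0 ((1 - \<alpha>) / \<alpha>) (\<gamma> / (\<alpha> * avg)))
                else 0)"
    using nn_integral_exponential_mixture[OF s x] by (auto simp: p_def fun_eq_iff s_def x_def)
  have p [measurable]: "p \<in> borel_measurable borel"
    unfolding p_def by measurable
  have X [measurable]: "?X \<in> borel_measurable M"
    unfolding instantaneous_snr_def sosf_signal_def \<omega>\<^sub>0 by simp
  have law: "(\<integral>\<^sup>+\<omega>. f (?X \<omega>) \<partial>M) = (\<integral>\<^sup>+y. p y * f y \<partial>lborel)"
    if [measurable]: "f \<in> borel_measurable borel" for f
  proof -
    have "(\<integral>\<^sup>+\<omega>. f (?X \<omega>) \<partial>M)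
      = (\<integral>\<^sup>+r. \<integral>\<^sup>+u. ennreal (exp (- r)) * ennreal (exp (- u)) * f (avg * ((\<omega>\<^sub>1\<^sup>2 + \<omega>\<^sub>2\<^sup>2 * r) * u))
         * indicator {0<..} u * indicator {0<..} r \<partial>lborel \<partial>lborel)"
      unfolding instantaneous_snr_def
      using nn_integral_sosf_signal[OF \<omega>\<^sub>0, of "\<lambda>v. f (avg * v)"] by simp
    also have "\<dots> = (\<integral>\<^sup>+r. \<integral>\<^sup>+y. ennreal (exp (- r)) * ennreal (exp (- y / (s * (x + r))) / (s * (x + r)))
         * indicator {0<..} r * f y * indicator {0<..} y \<partial>lborel \<partial>lborel)"
    proof (rule nn_integral_cong)
      fix r :: real
      show "(\<integral>\<^sup>+u. ennreal (exp (- r)) * ennreal (exp (- u)) * f (avg * ((\<omega>\<^sub>1\<^sup>2 + \<omega>\<^sub>2\<^sup>2 * r) * u))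
         * indicator {0<..} u * indicator {0<..} r \<partial>lborel)
       = (\<integral>\<^sup>+y. ennreal (exp (- r)) * ennreal (exp (- y / (s * (x + r))) / (s * (x + r)))
         * indicator {0<..} r * f y * indicator {0<..} y \<partial>lborel)"
      \<comment> \<open>The conditional mean is positive only under this assumption in general, as
        \<open>x\<close> may be 0; otherwise the indicator in \<open>r\<close> annihilates both
        sides.\<close>
      proof (cases "r > 0")
        case True
        then have "s * (x + r) > 0" using s x by simp
        from nn_integral_exponential_scale[OF that this] True show ?thesis
          by (simp add: mult.assoc[symmetric] scale)
            (simp add: mult.assoc nn_integral_cmult)
      qed simp
    qed
    also have "\<dots> = (\<integral>\<^sup>+y. \<integral>\<^sup>+r. ennreal (exp (- r)) * ennreal (exp (- y / (s * (x + r))) / (s * (x + r)))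
         * indicator {0<..} r * f y * indicator {0<..} y \<partial>lborel \<partial>lborel)"
      by (rule lborel_pair.Fubini') measurable
    also have "\<dots> = (\<integral>\<^sup>+y. p y * f y \<partial>lborel)"
      unfolding p_def by (intro nn_integral_cong) (simp add: nn_integral_multc, simp add: mult_ac)
    finally show ?thesis .
  qed
  \<comment> \<open>Indicator functions as test functions in \<open>law\<close> identify the two
    measures.\<close>
  have "distr M lborel ?X = density lborel p"
  proof (rule measure_eqI)
    fix A assume "A \<in> sets (distr M lborel ?X)"
    then have A [measurable]: "A \<in> sets borel" by simp
    have "emeasure (distr M lborel ?X) A = (\<integral>\<^sup>+y. indicator A y \<partial>distr M lborel ?X)"
      by simp
    also have "\<dots> = (\<integral>\<^sup>+\<omega>. indicator A (?X \<omega>) \<partial>M)"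
      by (rule nn_integral_distr) simp_all
    also have "\<dots> = emeasure (density lborel p) A"
      by (simp add: law emeasure_density)
    finally show "emeasure (distr M lborel ?X) A = emeasure (density lborel p) A" .
  qed simp
  then show ?thesis
    unfolding p_eq[symmetric] distributed_def using p X by simp
qed

end
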